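(* Let $G$ be an undirected quantum graph, potentially containing loops, with corresponding operator space $S$, and let $X\sqsubseteq V(G)$ be a projective subset. Then $X$ is a weak independent set, i.e. $(X\times X)\setminus\Delta$ and $E(G)$ are disjoint, if and only if the projection $\widetilde X\in V(G)$ is an independent set of $G$ in the sense of Weaver, i.e. $\widetilde XS\widetilde X\subseteq\widetilde XV(G)'\widetilde X$.
   Context: All Hilbert spaces are finite-dimensional; "projector" means orthogonal projector. Quantum sets. A quantum set is a special symmetric $\dagger$-Frobenius monoid in finite-dimensional Hilbert spaces; equivalently a finite-dimensional C*-algebra, up to isomorphism $X=\bigoplus_{i=1}^k M_{n_i}$ with the usual product, unit $1$ and involution, and inner product $\langle a,b\rangle=\sum_i n_i\mathrm{Tr}(a_i^*b_i)$, for which the multiplication $m:X\otimes X\to X$ satisfies $mm^\dagger=\mathrm{id}_X$. It acts block-diagonally on $H=\bigoplus_i\mathbb{C}^{n_i}$, so $X\subseteq B(H)$; $X'$ denotes the commutant in $B(H)$. Projective subsets. A projective subset $Y\sqsubseteq X$ is given by a projector $\widehat Y:X\to X$ with $\widehat Y(ab)=\widehat Y(a)b$ for all $a,b\in X$. These correspond bijectively to projections $\widetilde Y=\widehat Y(1)\in X$, via $\widehat Y(a)=\widetilde Ya$; $\widetilde Y$ is also viewed as a projector on $H$. The complement $Y^c$ has projection $1-\widetilde Y$; the intersection $Y\cap Z$ has as its projection the projector onto $\mathrm{img}\,\widetilde Y\cap\mathrm{img}\,\widetilde Z$; $Y\setminus Z=Y\cap Z^c$. $Y,Z\sqsubseteq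 X$ are disjoint if $\mathrm{img}\,\widetilde Y\perp\mathrm{img}\,\widetilde Z$. Cartesian products. For $V\subseteq B(H)$, the quantum set $V^{op}\otimes V$ acts on $H^*\otimes H\cong B(H)$ (identify $\langle u|\otimes|v\rangle$ with $|v\rangle\langle u|$) by $(a\otimes b)\cdot x=bxa$; thus projections in $V^{op}\otimes V$ have images in $B(H)$, which carries the Hilbert–Schmidt inner product. For $Y,Z\sqsubseteq V$, $Y\times Z\sqsubseteq V^{op}\otimes V$ is the projective subset whose projection acts on $B(H)$ as $x\mapsto\widetilde Zx\widetilde Y$. The diagonal relation $\Delta\sqsubseteq V^{op}\otimes V$ is the projective subset with $\mathrm{img}\,\widetilde\Delta=V'\subseteq B(H)$. Quantum graphs. A quantum graph $G$ is a quantum set $V=V(G)$ with an adjacency operator $A_G:V\to V$ satisfying $m(A_G\otimes A_G)m^\dagger=A_G$ and $A_G(x^* )=A_G(x)^*$. Equivalently, it is given by its edge relation $E(G)\sqsubseteq V^{op}\otimes V$, i.e. a projector $\widehat{E(G)}$ on $V\otimes V$ with $\widehat{E(G)}(ax\otimes yb)=(a\otimes 1)\widehat{E(G)}(x\otimes y)(1\otimes b)$, related by $\widehat{E(G)}=(\mathrm{id}\otimes m)(\mathrm{id}\otimes A_G\otimes\mathrm{id})(m^\dagger\otimes\mathrm{id})$. $G$ is undirected if $A_G=A_G^\dagger$. The corresponding operator space of $G$ is $S=\mathrm{img}\,\widetilde{E(G)}\subseteq B(H)$. *)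

theory Defs
  imports "HOL-Analysis.Analysis"
begin

type_synonym 'n cmat = "complex^'n^'n"

definition cscale :: "complex \<Rightarrow> 'n::finite cmat \<Rightarrow> 'n cmat" where
  "cscale c a = (\<chi> i j. c * a $ i $ j)"

definition dagger :: "'n::finite cmat \<Rightarrow> 'n cmat" where
  "dagger a = (\<chi> i j. cnj (a $ j $ i))"

definition hs_inner :: "'n::finite cmat \<Rightarrow> 'n cmat \<Rightarrow> complex" where
  "hs_inner x y = trace (dagger x ** y)"


section \<open>Quantum sets\<close>

text \<open>
  A quantum set \<open>\<Oplus>\<^sub>\<beta> M(n\<^sub>\<beta>)\<close> is presented by an orthonormal basis \<open>idx V\<close> of
  the Hilbert space \<open>H\<close> on which it acts, together with the assignment \<open>blk V\<close> of basis
  vectors to summands, so that \<open>n\<^sub>\<beta>\<close> is the number of \<open>i \<in> idx V\<close> with \<open>blk V i = \<beta>\<close>.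
  Operators on \<open>H\<close> are the matrices supported on \<open>idx V \<times> idx V\<close>. The basis is a subset
  of the index type, rather than the whole type, so that the zero algebra is included.
\<close>

record ('n, 'b) qset =
  idx :: "'n set"
  blk :: "'n \<Rightarrow> 'b"

definition ops :: "('n::finite, 'b) qset \<Rightarrow> 'n cmat set" where
  "ops V = {x. \<forall>i j. x $ i $ j \<noteq> 0 \<longrightarrow> i \<in> idx V \<and> j \<in> idx V}"

definition alg :: "('n::finite, 'b) qset \<Rightarrow> 'n cmat set" where
  "alg V = {a \<in> ops V. \<forall>i j. a $ i $ j \<noteq> 0 \<longrightarrow> blk V i = blk V j}"

definition one_of :: "('n::finite, 'b) qset \<Rightarrow> 'n cmat" where
  "one_of V = (\<chi> i j. if i = j \<and> i \<in> idx V then 1 else 0)"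

definition commutant :: "('n::finite, 'b) qset \<Rightarrow> 'n cmat set" where
  "commutant V = {x \<in> ops V. \<forall>a \<in> alg V. x ** a = a ** x}"

definition block_dim :: "('n::finite, 'b) qset \<Rightarrow> 'b \<Rightarrow> nat" where
  "block_dim V \<beta> = card {i \<in> idx V. blk V i = \<beta>}"

definition summand :: "('n::finite, 'b) qset \<Rightarrow> 'b \<Rightarrow> 'n cmat \<Rightarrow> 'n cmat" where
  "summand V \<beta> a = (\<chi> i j. if i \<in> idx V \<and> j \<in> idx V \<and> blk V i = \<beta> \<and> blk V j = \<beta>
                              then a $ i $ j else 0)"

definition ip :: "('n::finite, 'b) qset \<Rightarrow> 'n cmat \<Rightarrow> 'n cmat \<Rightarrow> complex" where
  "ip V a b = (\<Sum>\<beta> \<in> blk V ` idx V.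
      of_nat (block_dim V \<beta>) * trace (dagger (summand V \<beta> a) ** summand V \<beta> b))"

text \<open>Maps between quantum sets are HOL functions of which only the values on \<open>alg\<close> matter.\<close>

definition clinear_map ::
    "('n::finite, 'b) qset \<Rightarrow> ('m::finite, 'c) qset \<Rightarrow> ('n cmat \<Rightarrow> 'm cmat) \<Rightarrow> bool" where
  "clinear_map V W f \<longleftrightarrow> f ` alg V \<subseteq> alg W
     \<and> (\<forall>a \<in> alg V. \<forall>b \<in> alg V. f (a + b) = f a + f b)
     \<and> (\<forall>c. \<forall>a \<in> alg V. f (cscale c a) = cscale c (f a))"

definition adj ::
    "('n::finite, 'b) qset \<Rightarrow> ('m::finite, 'c) qset \<Rightarrow> ('n cmat \<Rightarrow> 'm cmat) \<Rightarrow> 'm cmat \<Rightarrow> 'n cmat" where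
  "adj V W f w = (THE v. v \<in> alg V \<and> (\<forall>u \<in> alg V. ip W (f u) w = ip V u v))"


section \<open>Tensor products\<close>

text \<open>
  Since summand dimensions and traces are multiplicative, \<open>ip (tensor V W)\<close> is the inner product
  of the Hilbert space tensor product.
\<close>

definition tensor ::
    "('n, 'b) qset \<Rightarrow> ('m, 'c) qset \<Rightarrow> ('n \<times> 'm, 'b \<times> 'c) qset" where
  "tensor V W = \<lparr>idx = idx V \<times> idx W, blk = map_prod (blk V) (blk W)\<rparr>"

definition kron :: "'n::finite cmat \<Rightarrow> 'm::finite cmat \<Rightarrow> ('n \<times> 'm) cmat" where
  "kron a b = (\<chi> p q. a $ fst p $ fst q * b $ snd p $ snd q)"

text \<open>
  The linear extension of \<open>a \<otimes> b \<mapsto> f a \<otimes> g b\<close>, computed on the matrix units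
  \<open>axis i (axis j 1)\<close>. If \<open>f\<close> and \<open>g\<close> are only linear on block-diagonal matrices, the
  arbitrary values at the remaining matrix units are multiplied by zero coefficients.
\<close>

definition tensor_map ::
    "('a::finite cmat \<Rightarrow> 'c::finite cmat) \<Rightarrow> ('b::finite cmat \<Rightarrow> 'd::finite cmat)
     \<Rightarrow> ('a \<times> 'b) cmat \<Rightarrow> ('c \<times> 'd) cmat" where
  "tensor_map f g T = (\<Sum>i\<in>UNIV. \<Sum>j\<in>UNIV. \<Sum>k\<in>UNIV. \<Sum>l\<in>UNIV.
      cscale (T $ (i, k) $ (j, l)) (kron (f (axis i (axis j 1))) (g (axis k (axis l 1)))))"

definition assoc :: "(('a::finite \<times> 'b::finite) \<times> 'c::finite) cmat \<Rightarrow> ('a \<times> ('b \<times> 'c)) cmat" where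
  "assoc T = (\<chi> p q. T $ ((fst p, fst (snd p)), snd (snd p)) $ ((fst q, fst (snd q)), snd (snd q)))"

definition mult :: "('n::finite \<times> 'n) cmat \<Rightarrow> 'n cmat" where
  "mult T = (\<chi> i j. \<Sum>k\<in>UNIV. T $ (i, k) $ (k, j))"

definition comult :: "('n::finite, 'b) qset \<Rightarrow> 'n cmat \<Rightarrow> ('n \<times> 'n) cmat" where
  "comult V = adj (tensor V V) V mult"

text \<open>
  An element \<open>a \<otimes> b\<close> of \<open>V\<^sup>o\<^sup>p \<otimes> V\<close> is represented by \<open>kron a b\<close>, with \<open>a\<close> not transposed.
  Hence \<open>alg (tensor V V)\<close> is the underlying space, \<open>dagger\<close> the involution and
  \<open>one_of (tensor V V)\<close> the unit of \<open>V\<^sup>o\<^sup>p \<otimes> V\<close>, but its multiplication is \<open>opmult\<close>, and it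
  acts on operators on \<open>H\<close> by \<open>act\<close>; see \<open>opmult_kron\<close> and \<open>act_kron\<close> below.
\<close>

definition opmult :: "('n::finite \<times> 'n) cmat \<Rightarrow> ('n \<times> 'n) cmat \<Rightarrow> ('n \<times> 'n) cmat" where
  "opmult S T = (\<chi> p q. \<Sum>r\<in>UNIV. \<Sum>s\<in>UNIV.
      S $ (r, snd p) $ (fst q, s) * T $ (fst p, s) $ (r, snd q))"

definition act :: "('n::finite \<times> 'n) cmat \<Rightarrow> 'n cmat \<Rightarrow> 'n cmat" where
  "act T x = (\<chi> k j. \<Sum>l\<in>UNIV. \<Sum>i\<in>UNIV. T $ (i, k) $ (j, l) * x $ l $ i)"

lemma mult_kron: "mult (kron a b) = a ** b"
  by (simp add: mult_def kron_def matrix_matrix_mult_def)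

lemma opmult_kron: "opmult (kron a b) (kron c d) = kron (c ** a) (b ** d)"
  by (simp add: opmult_def kron_def matrix_matrix_mult_def vec_eq_iff sum_product mult_ac)

lemma dagger_kron: "dagger (kron a b) = kron (dagger a) (dagger b)"
  by (simp add: dagger_def kron_def vec_eq_iff)

lemma act_kron: "act (kron a b) x = b ** x ** a"
proof -
  have "(\<Sum>l\<in>UNIV. \<Sum>i\<in>UNIV. a $ i $ q * b $ p $ l * x $ l $ i)
      = (\<Sum>i\<in>UNIV. (\<Sum>l\<in>UNIV. b $ p $ l * x $ l $ i) * a $ i $ q)" for p q
    by (subst sum.swap) (simp add: sum_distrib_right sum_distrib_left mult_ac)
  then show ?thesis
    by (simp add: act_def kron_def matrix_matrix_mult_def vec_eq_iff)
qed


section \<open>Projective subsets\<close>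

definition projective_subset :: "('n::finite, 'b) qset \<Rightarrow> ('n cmat \<Rightarrow> 'n cmat) \<Rightarrow> bool" where
  "projective_subset V Y \<longleftrightarrow> clinear_map V V Y
     \<and> (\<forall>a \<in> alg V. Y (Y a) = Y a)
     \<and> (\<forall>a \<in> alg V. \<forall>b \<in> alg V. ip V (Y a) b = ip V a (Y b))
     \<and> (\<forall>a \<in> alg V. \<forall>b \<in> alg V. Y (a ** b) = Y a ** b)"

definition projection_of :: "('n::finite, 'b) qset \<Rightarrow> ('n cmat \<Rightarrow> 'n cmat) \<Rightarrow> 'n cmat" where
  "projection_of V Y = Y (one_of V)"

text \<open>
  Projective subsets of \<open>V\<^sup>o\<^sup>p \<otimes> V\<close> are handled through their projections
  \<open>p \<in> V\<^sup>o\<^sup>p \<otimes> V\<close>; \<open>img V p\<close> is the image of \<open>p\<close> as a projector on the operators on \<open>H\<close>.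
\<close>

definition op_projection :: "('n::finite, 'b) qset \<Rightarrow> ('n \<times> 'n) cmat \<Rightarrow> bool" where
  "op_projection V p \<longleftrightarrow> p \<in> alg (tensor V V) \<and> dagger p = p \<and> opmult p p = p"

definition img :: "('n::finite, 'b) qset \<Rightarrow> ('n \<times> 'n) cmat \<Rightarrow> 'n cmat set" where
  "img V p = act p ` ops V"

definition projection_onto :: "('n::finite, 'b) qset \<Rightarrow> 'n cmat set \<Rightarrow> ('n \<times> 'n) cmat" where
  "projection_onto V S = (THE p. op_projection V p \<and> img V p = S)"

definition compl :: "('n::finite, 'b) qset \<Rightarrow> ('n \<times> 'n) cmat \<Rightarrow> ('n \<times> 'n) cmat" where
  "compl V p = one_of (tensor V V) - p"

definition inter ::
    "('n::finite, 'b) qset \<Rightarrow> ('n \<times> 'n) cmat \<Rightarrow> ('n \<times> 'n) cmat \<Rightarrow> ('n \<times> 'n) cmat" where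
  "inter V p q = projection_onto V (img V p \<inter> img V q)"

definition setdiff ::
    "('n::finite, 'b) qset \<Rightarrow> ('n \<times> 'n) cmat \<Rightarrow> ('n \<times> 'n) cmat \<Rightarrow> ('n \<times> 'n) cmat" where
  "setdiff V p q = inter V p (compl V q)"

definition disjoint_proj ::
    "('n::finite, 'b) qset \<Rightarrow> ('n \<times> 'n) cmat \<Rightarrow> ('n \<times> 'n) cmat \<Rightarrow> bool" where
  "disjoint_proj V p q \<longleftrightarrow> (\<forall>x \<in> img V p. \<forall>y \<in> img V q. hs_inner x y = 0)"

text \<open>By \<open>act_kron\<close>, the projection of \<open>Y \<times> Z\<close> acts as \<open>x \<mapsto> z x y\<close>.\<close>

definition cart_prod ::
    "('n::finite, 'b) qset \<Rightarrow> ('n cmat \<Rightarrow> 'n cmat) \<Rightarrow> ('n cmat \<Rightarrow> 'n cmat) \<Rightarrow> ('n \<times> 'n) cmat" where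
  "cart_prod V Y Z = kron (projection_of V Y) (projection_of V Z)"

definition diagonal :: "('n::finite, 'b) qset \<Rightarrow> ('n \<times> 'n) cmat" where
  "diagonal V = projection_onto V (commutant V)"


section \<open>Quantum graphs\<close>

definition quantum_graph :: "('n::finite, 'b) qset \<Rightarrow> ('n cmat \<Rightarrow> 'n cmat) \<Rightarrow> bool" where
  "quantum_graph V A \<longleftrightarrow> clinear_map V V A
     \<and> (\<forall>x \<in> alg V. mult (tensor_map A A (comult V x)) = A x)
     \<and> (\<forall>x \<in> alg V. A (dagger x) = dagger (A x))"

definition undirected :: "('n::finite, 'b) qset \<Rightarrow> ('n cmat \<Rightarrow> 'n cmat) \<Rightarrow> bool" where
  "undirected V A \<longleftrightarrow> (\<forall>x \<in> alg V. A x = adj V V A x)"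

definition edge_map ::
    "('n::finite, 'b) qset \<Rightarrow> ('n cmat \<Rightarrow> 'n cmat) \<Rightarrow> ('n \<times> 'n) cmat \<Rightarrow> ('n \<times> 'n) cmat" where
  "edge_map V A T =
     tensor_map id mult (assoc (tensor_map (tensor_map id A) id (tensor_map (comult V) id T)))"

definition edge_relation ::
    "('n::finite, 'b) qset \<Rightarrow> ('n cmat \<Rightarrow> 'n cmat) \<Rightarrow> ('n \<times> 'n) cmat" where
  "edge_relation V A = projection_of (tensor V V) (edge_map V A)"

definition operator_space :: "('n::finite, 'b) qset \<Rightarrow> ('n cmat \<Rightarrow> 'n cmat) \<Rightarrow> 'n cmat set" where
  "operator_space V A = img V (edge_relation V A)"

definition weak_independent_set ::
    "('n::finite, 'b) qset \<Rightarrow> ('n cmat \<Rightarrow> 'n cmat) \<Rightarrow> ('n cmat \<Rightarrow> 'n cmat) \<Rightarrow> bool" where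
  "weak_independent_set V A X \<longleftrightarrow>
     disjoint_proj V (setdiff V (cart_prod V X X) (diagonal V)) (edge_relation V A)"

definition weaver_independent_set ::
    "('n::finite, 'b) qset \<Rightarrow> 'n cmat set \<Rightarrow> 'n cmat \<Rightarrow> bool" where
  "weaver_independent_set V S p \<longleftrightarrow>
     (\<lambda>s. p ** s ** p) ` S \<subseteq> (\<lambda>v. p ** v ** p) ` commutant V"

end

theory Submission
  imports Defs
begin

text \<open>
  Write \<open>p\<close> for the projection of \<open>X\<close>, \<open>B\<close> for the operators on \<open>H\<close>, \<open>V'\<close> for the commutant
  and \<open>S\<close> for the operator space of the graph. The projective subset \<open>(X \<times> X) \<setminus> \<Delta>\<close> has
  image \<open>W = pBp \<inter> V'\<^sup>\<bottom>\<close> (lemma \<open>img_setdiff_diagonal\<close>). Since \<open>p\<close> is a self-adjoint idempotent,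
  \<open>\<langle>pxp, y\<rangle> = \<langle>x, pyp\<rangle>\<close>. Hence \<open>W\<close> is the orthogonal complement of \<open>pV'p\<close> inside the
  corner \<open>pBp\<close>, and \<open>W\<close> is orthogonal to \<open>S\<close> iff it is orthogonal to \<open>pSp\<close>. As \<open>pBp\<close> has finite
  dimension, this says that \<open>pSp\<close> lies in the double complement of \<open>pV'p\<close>, which is \<open>pV'p\<close>
  itself: Weaver's condition.

  The substance behind this short computation is that \<open>\<Delta>\<close> and the intersection exist as projections
  in \<open>V\<^sup>o\<^sup>p \<otimes> V\<close>, so that the definite descriptions that introduce them have the intended
  images. Every subspace of \<open>B\<close> that is a bimodule over \<open>V'\<close> is the image of exactly one such
  projection (lemma \<open>projection_onto_bimodule\<close>). The orthogonal projection onto the subspace commutes with left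
  and right multiplication by the central projections of the blocks, and the algebra
  \<open>V\<^sup>o\<^sup>p \<otimes> V\<close> consists of all linear maps on \<open>B\<close> with this property. Both \<open>V'\<close> and \<open>W\<close> are
  bimodules of this kind.
\<close>

section \<open>The Hilbert-Schmidt inner product\<close>

lemma hs_inner_sum: "hs_inner x y = (\<Sum>i\<in>UNIV. \<Sum>j\<in>UNIV. cnj (x $ i $ j) * y $ i $ j)"
  unfolding hs_inner_def trace_def dagger_def matrix_matrix_mult_def
  by (subst sum.swap) simp

lemma cnj_hs_inner: "cnj (hs_inner x y) = hs_inner y x"
  by (simp add: hs_inner_sum mult.commute)

lemma hs_inner_diff_right: "hs_inner x (y - z) = hs_inner x y - hs_inner x z"
  by (simp add: hs_inner_sum algebra_simps sum_subtractf)

lemma hs_inner_zero_right: "hs_inner x 0 = 0"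
  and hs_inner_add_right: "hs_inner x (y + z) = hs_inner x y + hs_inner x z"
  and hs_inner_cscale_right: "hs_inner x (cscale c y) = c * hs_inner x y"
  by (simp_all add: hs_inner_sum cscale_def algebra_simps sum.distrib sum_distrib_left)

lemma hs_inner_cscale_left: "hs_inner (cscale c x) y = cnj c * hs_inner x y"
  by (simp add: hs_inner_sum cscale_def sum_distrib_left mult.assoc)

lemma Re_hs_inner: "Re (hs_inner x y) = x \<bullet> y"
  by (simp add: hs_inner_sum inner_vec_def inner_complex_def)

lemma hs_inner_self_eq_0: "hs_inner x x = 0 \<Longrightarrow> x = 0"
  by (metis Re_hs_inner inner_eq_zero_iff zero_complex.sel(1))

lemma dagger_mult: "dagger (a ** b) = dagger b ** dagger a"
  by (simp add: dagger_def matrix_matrix_mult_def vec_eq_iff mult.commute)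

lemma dagger_dagger [simp]: "dagger (dagger a) = a"
  by (simp add: dagger_def vec_eq_iff)

lemma hs_inner_mult_left: "hs_inner x (a ** y) = hs_inner (dagger a ** x) y"
  by (simp add: hs_inner_def dagger_mult matrix_mul_assoc)

lemma hs_inner_mult_right: "hs_inner x (y ** b) = hs_inner (x ** dagger b) y"
  by (metis hs_inner_def dagger_mult dagger_dagger matrix_mul_assoc trace_mul_sym)

lemma hs_inner_compress: "hs_inner x (a ** y ** b) = hs_inner (dagger a ** x ** dagger b) y"
  by (simp only: hs_inner_mult_right[of x "a ** y"] hs_inner_mult_left[of _ a y] matrix_mul_assoc)

lemma axis_axis_nth: "axis i (axis j 1) $ k $ l = (if k = i \<and> l = j then 1 else (0::complex))"
  by (auto simp: axis_def)

lemma sum_unit: "(\<Sum>i\<in>UNIV. \<Sum>j\<in>UNIV. if i = k \<and> j = l then f i j else 0) = f k l"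
  for f :: "'n::finite \<Rightarrow> 'm::finite \<Rightarrow> complex"
proof -
  have "(\<Sum>j\<in>UNIV. if i = k \<and> j = l then f i j else 0) = (if i = k then f i l else 0)" for i
    by (cases "i = k") simp_all
  then show ?thesis by simp
qed

lemma hs_inner_unit_left: "hs_inner (axis k (axis l 1)) y = y $ k $ l"
proof -
  have "cnj (axis k (axis l 1) $ i $ j) * y $ i $ j = (if i = k \<and> j = l then y $ i $ j else 0)" for i j
    by (simp add: axis_axis_nth)
  then show ?thesis unfolding hs_inner_sum by (simp add: sum_unit)
qed


section \<open>Orthogonal projections onto complex subspaces\<close>

definition csubspace :: "'n::finite cmat set \<Rightarrow> bool" where
  "csubspace S \<longleftrightarrow> 0 \<in> S \<and> (\<forall>x\<in>S. \<forall>y\<in>S. x + y \<in> S) \<and> (\<forall>c. \<forall>x\<in>S. cscale c x \<in> S)"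

lemma csubspace_diff: "csubspace S \<Longrightarrow> x \<in> S \<Longrightarrow> y \<in> S \<Longrightarrow> x - y \<in> S"
proof -
  assume S: "csubspace S" "x \<in> S" "y \<in> S"
  have "x - y = x + cscale (-1) y" by (simp add: cscale_def vec_eq_iff)
  with S show ?thesis unfolding csubspace_def by metis
qed

lemma csubspace_image:
  assumes "csubspace S" "\<And>x y. f (x + y) = f x + f y" "\<And>c x. f (cscale c x) = cscale c (f x)"
  shows "csubspace (f ` S)"
proof -
  have "f 0 + f 0 = f 0" using assms(2)[of 0 0] by simp
  then have "0 = f 0" by simp
  then show ?thesis using assms
    unfolding csubspace_def by (force simp flip: assms(2,3))
qed

text \<open>
  Over the reals the decomposition is the usual one, because the real part of the
  Hilbert-Schmidt product is the Euclidean inner product. Stability under multiplication by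
  \<open>\<i>\<close> upgrades real orthogonality to complex orthogonality.
\<close>

lemma orthogonal_decomposition:
  assumes "csubspace S"
  obtains y where "y \<in> S" "\<forall>s\<in>S. hs_inner s (x - y) = 0"
proof -
  have real: "scaleR r z = cscale (of_real r) z" for r and z :: "'a cmat"
    by (simp add: cscale_def vec_eq_iff scaleR_conv_of_real[symmetric])
  have sub: "subspace S"
    using assms by (simp add: subspace_def csubspace_def real)
  obtain y z where yz: "y \<in> span S" "\<And>w. w \<in> span S \<Longrightarrow> orthogonal z w" "x = y + z"
    using orthogonal_subspace_decomp_exists by blast
  have S: "span S = S" using sub by (simp add: span_eq_iff)
  have Re0: "Re (hs_inner s z) = 0" if "s \<in> S" for s
    using yz(2)[of s] that S by (simp add: Re_hs_inner orthogonal_def inner_commute)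
  have "hs_inner s z = 0" if "s \<in> S" for s
  proof (rule complex_eqI)
    have "cscale \<i> s \<in> S" using assms that by (simp add: csubspace_def)
    from Re0[OF this] show "Im (hs_inner s z) = Im 0" by (simp add: hs_inner_cscale_left)
  qed (simp add: Re0 that)
  then show thesis using that[of y] yz S by simp
qed

definition hs_proj :: "'n::finite cmat set \<Rightarrow> 'n cmat \<Rightarrow> 'n cmat" where
  "hs_proj S x = (SOME y. y \<in> S \<and> (\<forall>s\<in>S. hs_inner s (x - y) = 0))"

lemma
  assumes "csubspace S"
  shows hs_proj_in: "hs_proj S x \<in> S"
    and hs_proj_orthogonal: "s \<in> S \<Longrightarrow> hs_inner s (x - hs_proj S x) = 0"
proof -
  have "hs_proj S x \<in> S \<and> (\<forall>s\<in>S. hs_inner s (x - hs_proj S x) = 0)"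
    unfolding hs_proj_def by (rule someI_ex) (metis orthogonal_decomposition[OF assms])
  then show "hs_proj S x \<in> S" "s \<in> S \<Longrightarrow> hs_inner s (x - hs_proj S x) = 0" by auto
qed

lemma orthogonal_decomposition_unique:
  assumes "csubspace S" "y \<in> S" "z \<in> S"
    and "\<And>s. s \<in> S \<Longrightarrow> hs_inner s (x - y) = 0" "\<And>s. s \<in> S \<Longrightarrow> hs_inner s (x - z) = 0"
  shows "y = z"
proof -
  have d: "y - z \<in> S" using csubspace_diff assms(1-3) .
  have "hs_inner (y - z) (y - z) = hs_inner (y - z) (x - z) - hs_inner (y - z) (x - y)"
    by (simp add: hs_inner_diff_right)
  also have "\<dots> = 0" using d assms(4,5) by simp
  finally have "y - z = 0" by (rule hs_inner_self_eq_0)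
  then show ?thesis by simp
qed

lemma hs_proj_eqI:
  assumes "csubspace S" "y \<in> S" "\<And>s. s \<in> S \<Longrightarrow> hs_inner s (x - y) = 0"
  shows "hs_proj S x = y"
  using orthogonal_decomposition_unique[OF assms(1) hs_proj_in assms(2) hs_proj_orthogonal assms(3)]
    assms(1) by blast

text \<open>Both sides equal \<open>\<langle>hs_proj S x, hs_proj S y\<rangle>\<close>.\<close>

lemma hs_proj_self_adjoint:
  assumes "csubspace S"
  shows "hs_inner (hs_proj S x) y = hs_inner x (hs_proj S y)"
proof -
  have 1: "hs_inner (hs_proj S u) v = hs_inner (hs_proj S u) (hs_proj S v)" for u v
    using hs_proj_orthogonal[OF assms hs_proj_in[OF assms]] by (simp add: hs_inner_diff_right)
  show ?thesis by (metis 1 cnj_hs_inner)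
qed


section \<open>The action of \<open>V\<^sup>o\<^sup>p \<otimes> V\<close> on operators\<close>

text \<open>
  The entries of \<open>T\<close> are, after reordering the indices, the matrix coefficients of \<open>act T\<close> in the
  basis of matrix units; hence \<open>act\<close> is faithful on all matrices.
\<close>

lemma act_unit: "act T (axis l (axis i 1)) $ k $ j = T $ (i, k) $ (j, l)"
proof -
  have "T $ (i', k) $ (j, l') * axis l (axis i 1) $ l' $ i'
      = (if l' = l \<and> i' = i then T $ (i', k) $ (j, l') else 0)" for i' l'
    by (simp add: axis_axis_nth)
  then show ?thesis by (simp add: act_def sum_unit)
qed

lemma act_inject: "(\<And>x. act S x = act T x) \<Longrightarrow> S = T"
  by (simp add: vec_eq_iff act_unit[symmetric])

lemma act_opmult: "act (opmult S T) x = act S (act T x)"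
proof -
  have "(\<Sum>l\<in>UNIV. \<Sum>i\<in>UNIV. (\<Sum>r\<in>UNIV. \<Sum>s\<in>UNIV. S $ (r, k) $ (j, s) * T $ (i, s) $ (r, l)) * x $ l $ i)
      = (\<Sum>s\<in>UNIV. \<Sum>r\<in>UNIV. S $ (r, k) $ (j, s) * (\<Sum>l\<in>UNIV. \<Sum>i\<in>UNIV. T $ (i, s) $ (r, l) * x $ l $ i))" 
    (is "?L = ?R") for k j
  proof -
    have "?L = (\<Sum>(l,i,r,s)\<in>UNIV. S $ (r, k) $ (j, s) * T $ (i, s) $ (r, l) * x $ l $ i)"
      by (simp add: sum_distrib_right sum.cartesian_product case_prod_unfold)
    also have "\<dots> = (\<Sum>(s,r,l,i)\<in>UNIV. S $ (r, k) $ (j, s) * T $ (i, s) $ (r, l) * x $ l $ i)"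
      by (rule sum.reindex_bij_witness[of _ "\<lambda>(s,r,l,i). (l,i,r,s)" "\<lambda>(l,i,r,s). (s,r,l,i)"]) auto
    also have "\<dots> = ?R"
      by (simp add: sum_distrib_left sum.cartesian_product case_prod_unfold mult.assoc)
    finally show ?thesis .
  qed
  then show ?thesis by (simp add: act_def opmult_def vec_eq_iff)
qed

lemma hs_inner_act: "hs_inner (act T x) y = hs_inner x (act (dagger T) y)"
proof -
  have "hs_inner (act T x) y
      = (\<Sum>(k,j,l,i)\<in>UNIV. cnj (T $ (i, k) $ (j, l)) * cnj (x $ l $ i) * y $ k $ j)"
    by (simp add: hs_inner_sum act_def sum_distrib_right sum.cartesian_product
        case_prod_unfold)
  also have "\<dots> = (\<Sum>(l,i,k,j)\<in>UNIV. cnj (T $ (i, k) $ (j, l)) * cnj (x $ l $ i) * y $ k $ j)"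
    by (rule sum.reindex_bij_witness[of _ "\<lambda>(l,i,k,j). (k,j,l,i)" "\<lambda>(k,j,l,i). (l,i,k,j)"]) auto
  also have "\<dots> = hs_inner x (act (dagger T) y)"
    by (simp add: hs_inner_sum act_def dagger_def sum_distrib_left sum.cartesian_product
        case_prod_unfold mult_ac)
  finally show ?thesis .
qed

lemma act_diff_left: "act (S - T) x = act S x - act T x"
  by (simp add: act_def vec_eq_iff algebra_simps sum_subtractf)

lemma act_add: "act T (x + y) = act T x + act T y"
  and act_cscale: "act T (cscale c x) = cscale c (act T x)"
  by (simp_all add: act_def cscale_def vec_eq_iff algebra_simps sum.distrib sum_distrib_left)

lemma alg_tensor_iff: "T \<in> alg (tensor V V) \<longleftrightarrow> (\<forall>i k j l. T $ (i, k) $ (j, l) \<noteq> 0 \<longrightarrow>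
    i \<in> idx V \<and> k \<in> idx V \<and> j \<in> idx V \<and> l \<in> idx V \<and> blk V i = blk V j \<and> blk V k = blk V l)"
  by (auto simp: alg_def ops_def tensor_def)

lemma act_in_ops: "T \<in> alg (tensor V V) \<Longrightarrow> act T x \<in> ops V"
proof -
  assume T: "T \<in> alg (tensor V V)"
  have "act T x $ k $ j = 0" if "k \<notin> idx V \<or> j \<notin> idx V" for k j
  proof -
    have "T $ (i, k) $ (j, l) = 0" for i l using T that by (auto simp: alg_tensor_iff)
    then show ?thesis by (simp add: act_def)
  qed
  then show ?thesis unfolding ops_def by blast
qed

lemma ops_iff: "x \<in> ops V \<longleftrightarrow> (\<forall>i j. i \<notin> idx V \<or> j \<notin> idx V \<longrightarrow> x $ i $ j = 0)"
  unfolding ops_def by blast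

lemma csubspace_ops: "csubspace (ops V)"
  by (simp add: csubspace_def ops_iff cscale_def)

lemma csubspace_img: "csubspace (img V p)"
  unfolding img_def using csubspace_ops by (rule csubspace_image) (simp_all add: act_add act_cscale)

lemma coordinate_projection_mult:
  fixes x :: "'n::finite cmat"
  shows "((\<chi> i j. if i = j \<and> P i then 1 else 0) ** x) $ i $ j = (if P i then x $ i $ j else 0)"
    and "(x ** (\<chi> i j. if i = j \<and> P i then 1 else 0)) $ i $ j = (if P j then x $ i $ j else 0)"
proof -
  have "(if i = k \<and> P i then 1 else 0) * x $ k $ j = (if k = i then if P i then x $ i $ j else 0 else 0)"
    for k by simp
  then show "((\<chi> i j. if i = j \<and> P i then 1 else 0) ** x) $ i $ j = (if P i then x $ i $ j else 0)"
    by (simp add: matrix_matrix_mult_def)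
  have "x $ i $ k * (if k = j \<and> P k then 1 else 0) = (if k = j then if P j then x $ i $ j else 0 else 0)"
    for k by simp
  then show "(x ** (\<chi> i j. if i = j \<and> P i then 1 else 0)) $ i $ j = (if P j then x $ i $ j else 0)"
    by (simp add: matrix_matrix_mult_def)
qed

lemma one_of_mult_ops:
  assumes "x \<in> ops V" shows "one_of V ** x = x" "x ** one_of V = x"
  using assms by (simp_all add: one_of_def vec_eq_iff coordinate_projection_mult ops_iff)

lemma one_of_tensor: "one_of (tensor V V) = kron (one_of V) (one_of V)"
  by (auto simp: one_of_def tensor_def kron_def vec_eq_iff)

lemma corner_in_ops:
  assumes "a \<in> ops V" "b \<in> ops V"
  shows "a ** x ** b \<in> ops V"
proof -
  have "one_of V ** y ** one_of V \<in> ops V" for y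
    by (simp add: ops_iff one_of_def coordinate_projection_mult)
  moreover have "a ** x ** b = one_of V ** (a ** x ** b) ** one_of V"
    using one_of_mult_ops assms by (metis matrix_mul_assoc)
  ultimately show ?thesis by metis
qed

lemma mult_in_ops: "a \<in> ops V \<Longrightarrow> b \<in> ops V \<Longrightarrow> a ** b \<in> ops V"
  using corner_in_ops[of a V b "mat 1"] by simp

text \<open>
  With \<open>dagger\<close> as adjoint and \<open>opmult\<close> as composition, a projection acts as the orthogonal
  projection onto its image. This makes it determined by the image, up to its action on matrices that are
  not operators on \<open>H\<close>, where an element of the algebra vanishes.
\<close>

lemma op_projection_orthogonal:
  assumes "op_projection V p" "s \<in> img V p"
  shows "hs_inner s (x - act p x) = 0"
proof -
  obtain y where s: "s = act p y" using assms(2) by (auto simp: img_def)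
  have "dagger p = p" "opmult p p = p" using assms(1) by (auto simp: op_projection_def)
  then show ?thesis
    by (metis act_opmult diff_self hs_inner_act hs_inner_diff_right s)
qed

lemma op_projection_unique:
  assumes p: "op_projection V p" and q: "op_projection V q" and eq: "img V p = img V q"
  shows "p = q"
proof -
  have ops: "act p x = act q x" if "x \<in> ops V" for x
  proof (rule orthogonal_decomposition_unique[OF csubspace_img[of V p]])
    show "act p x \<in> img V p" using that by (auto simp: img_def)
    show "act q x \<in> img V p" using that unfolding eq by (auto simp: img_def)
    show "hs_inner s (x - act p x) = 0" "hs_inner s (x - act q x) = 0" if "s \<in> img V p" for s
      using op_projection_orthogonal p q eq that by blast+
  qed
  have "p $ (i, k) $ (j, l) = q $ (i, k) $ (j, l)" for i j k l
  proof (cases "l \<in> idx V \<and> i \<in> idx V")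
    case True
    then have "axis l (axis i 1) \<in> ops V" by (auto simp: ops_def axis_axis_nth)
    from ops[OF this] show ?thesis by (metis act_unit)
  next
    case False
    have "p \<in> alg (tensor V V)" "q \<in> alg (tensor V V)" using p q by (auto simp: op_projection_def)
    then have "p $ (i, k) $ (j, l) = 0" "q $ (i, k) $ (j, l) = 0"
      using False unfolding alg_tensor_iff by blast+
    then show ?thesis by simp
  qed
  then show ?thesis by (simp add: vec_eq_iff)
qed

lemma img_compl:
  assumes "op_projection V p"
  shows "img V (compl V p) = {x \<in> ops V. \<forall>y \<in> img V p. hs_inner y x = 0}"
proof -
  have pa: "p \<in> alg (tensor V V)" using assms by (simp add: op_projection_def)
  have c: "act (compl V p) x = x - act p x" if "x \<in> ops V" for x
    using that by (simp add: compl_def act_diff_left one_of_tensor act_kron one_of_mult_ops)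
  have "act p x = 0" if "x \<in> ops V" "\<forall>y \<in> img V p. hs_inner y x = 0" for x
  proof -
    have "act p x \<in> img V p" using that by (auto simp: img_def)
    then have "hs_inner (act p x) x = 0" "hs_inner (act p x) (x - act p x) = 0"
      using that op_projection_orthogonal[OF assms] by auto
    then show ?thesis using hs_inner_self_eq_0 by (simp add: hs_inner_diff_right)
  qed
  then have "x \<in> img V (compl V p)" if "x \<in> ops V" "\<forall>y \<in> img V p. hs_inner y x = 0" for x
    using that c[of x] unfolding img_def by (metis diff_zero imageI)
  moreover have "act (compl V p) x \<in> ops V \<and> (\<forall>y \<in> img V p. hs_inner y (act (compl V p) x) = 0)"
    if "x \<in> ops V" for x
    using c[OF that] op_projection_orthogonal[OF assms] csubspace_diff[OF csubspace_ops that act_in_ops[OF pa]]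
    by simp
  ultimately show ?thesis by (auto simp: img_def)
qed


section \<open>Bimodules over the commutant\<close>

definition bimodule :: "('n::finite, 'b) qset \<Rightarrow> 'n cmat set \<Rightarrow> bool" where
  "bimodule V S \<longleftrightarrow> S \<subseteq> ops V \<and> csubspace S
     \<and> (\<forall>v\<in>commutant V. \<forall>s\<in>S. v ** s \<in> S \<and> s ** v \<in> S)"

text \<open>
  The central projections of \<open>V\<close>. They span the commutant, because each summand acts on \<open>H\<close> with
  multiplicity one.
\<close>

definition block_projection :: "('n::finite, 'b) qset \<Rightarrow> 'b \<Rightarrow> 'n cmat" where
  "block_projection V \<beta> = (\<chi> i j. if i = j \<and> i \<in> idx V \<and> blk V i = \<beta> then 1 else 0)"

lemma block_projection_mult:
  "(block_projection V \<beta> ** x) $ i $ j = (if i \<in> idx V \<and> blk V i = \<beta> then x $ i $ j else 0)"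
  "(x ** block_projection V \<beta>) $ i $ j = (if j \<in> idx V \<and> blk V j = \<beta> then x $ i $ j else 0)"
  unfolding block_projection_def by (rule coordinate_projection_mult)+

lemma block_projection_in_commutant: "block_projection V \<beta> \<in> commutant V"
proof -
  have "block_projection V \<beta> ** a = a ** block_projection V \<beta>" if "a \<in> alg V" for a
    using that by (auto simp: vec_eq_iff block_projection_mult alg_def ops_def) (metis)+
  then show ?thesis
    by (simp add: commutant_def) (auto simp: ops_def block_projection_def split: if_splits)
qed

lemma dagger_block_projection: "dagger (block_projection V \<beta>) = block_projection V \<beta>"
  by (auto simp: dagger_def block_projection_def vec_eq_iff)

text \<open>
  Compression by block projections is self-adjoint and preserves the bimodule, so it preserves
  the orthogonal decomposition along the bimodule.
\<close>

lemma hs_proj_block_projection: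
  assumes "bimodule V S"
  shows "hs_proj S (block_projection V \<beta> ** x ** block_projection V \<gamma>)
       = block_projection V \<beta> ** hs_proj S x ** block_projection V \<gamma>"
proof (rule hs_proj_eqI)
  let ?b = "block_projection V \<beta>" and ?c = "block_projection V \<gamma>"
  show S: "csubspace S" using assms by (simp add: bimodule_def)
  have bim: "?b ** s ** ?c \<in> S" if "s \<in> S" for s
    using assms that block_projection_in_commutant unfolding bimodule_def by metis
  show "?b ** hs_proj S x ** ?c \<in> S" using bim hs_proj_in[OF S] .
  fix s assume "s \<in> S"
  have "?b ** x ** ?c - ?b ** hs_proj S x ** ?c = ?b ** (x - hs_proj S x) ** ?c"
    unfolding vec_eq_iff vector_minus_component block_projection_mult by auto
  then have "hs_inner s (?b ** x ** ?c - ?b ** hs_proj S x ** ?c)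
      = hs_inner (?b ** s ** ?c) (x - hs_proj S x)"
    by (simp add: hs_inner_compress dagger_block_projection)
  then show "hs_inner s (?b ** x ** ?c - ?b ** hs_proj S x ** ?c) = 0"
    using hs_proj_orthogonal[OF S bim[OF \<open>s \<in> S\<close>]] by simp
qed

text \<open>
  The matrix of the orthogonal projection onto \<open>S\<close> acts as that projection, so only membership in
  \<open>V\<^sup>o\<^sup>p \<otimes> V\<close> is at stake. A matrix unit lies in a single pair of blocks, and by
  \<open>hs_proj_block_projection\<close> so does its projection; this is exactly the support condition on the entries.
\<close>

lemma bimodule_projection_exists:
  assumes "bimodule V S"
  shows "\<exists>p. op_projection V p \<and> img V p = S"
proof -
  have S: "csubspace S" and SV: "S \<subseteq> ops V" using assms by (auto simp: bimodule_def)
  (* By self-adjointness of the projection, coordinate (k, j) of the projection of x is the inner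
     product of the projected matrix unit at (k, j) with x. Reading the coefficients off in this
     form makes the action of T a single inner product. *)
  define T :: "('a \<times> 'a) cmat" where
    "T = (\<chi> p q. cnj (hs_proj S (axis (snd p) (axis (fst q) 1)) $ snd q $ fst p))"
  have T: "T $ (i, k) $ (j, l) = cnj (hs_proj S (axis k (axis j 1)) $ l $ i)" for i j k l
    by (simp add: T_def)
  have actT: "act T x = hs_proj S x" for x
  proof -
    have "act T x $ k $ j = hs_proj S x $ k $ j" for k j
    proof -
      have "act T x $ k $ j = hs_inner (hs_proj S (axis k (axis j 1))) x"
        by (simp add: act_def T hs_inner_sum)
      also have "\<dots> = hs_proj S x $ k $ j"
        by (simp add: hs_proj_self_adjoint[OF S] hs_inner_unit_left)
      finally show ?thesis .
    qed
    then show ?thesis by (simp add: vec_eq_iff)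
  qed
  have fixed: "hs_proj S s = s" if "s \<in> S" for s
    using that by (intro hs_proj_eqI[OF S]) (auto simp: hs_inner_sum)
  have "T \<in> alg (tensor V V)"
    unfolding alg_tensor_iff
  proof (intro allI impI)
    fix i k j l assume nz: "T $ (i, k) $ (j, l) \<noteq> 0"
    let ?e = "axis k (axis j 1) :: 'a cmat"
    have nz': "hs_proj S ?e $ l $ i \<noteq> 0" using nz by (simp add: T)
    have li: "l \<in> idx V" "i \<in> idx V"
      using nz' hs_proj_in[OF S, of ?e] SV by (auto simp: ops_def)
    have "hs_inner s ?e = cnj (s $ k $ j)" for s
      by (metis cnj_hs_inner hs_inner_unit_left)
    then have "hs_proj S ?e = 0" if "\<not> (k \<in> idx V \<and> j \<in> idx V)"
      using that SV S by (intro hs_proj_eqI[OF S]) (auto simp: csubspace_def ops_def)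
    then have kj: "k \<in> idx V" "j \<in> idx V" using nz' by fastforce+
    have "?e = block_projection V (blk V k) ** ?e ** block_projection V (blk V j)"
      using kj by (auto simp: vec_eq_iff block_projection_mult axis_axis_nth)
    then have "hs_proj S ?e
        = block_projection V (blk V k) ** hs_proj S ?e ** block_projection V (blk V j)"
      by (metis hs_proj_block_projection[OF assms])
    then have "hs_proj S ?e $ l $ i
        = (block_projection V (blk V k) ** hs_proj S ?e ** block_projection V (blk V j)) $ l $ i"
      by simp
    with nz' have "blk V l = blk V k" "blk V i = blk V j"
      by (auto simp: block_projection_mult split: if_splits)
    with li kj show "i \<in> idx V \<and> k \<in> idx V \<and> j \<in> idx V \<and> l \<in> idx V
        \<and> blk V i = blk V j \<and> blk V k = blk V l" by simp
  qed
  moreover have "dagger T = T"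
  proof -
    have "cnj (T $ (j, l) $ (i, k)) = T $ (i, k) $ (j, l)" for i j k l
      by (metis T actT act_unit complex_cnj_cnj)
    then show ?thesis by (simp add: dagger_def vec_eq_iff)
  qed
  moreover have "opmult T T = T"
    by (rule act_inject) (simp add: act_opmult actT fixed hs_proj_in[OF S])
  moreover have "img V T = S"
    using SV fixed hs_proj_in[OF S] by (force simp: img_def actT image_iff)
  ultimately show ?thesis unfolding op_projection_def by blast
qed

lemma projection_onto_bimodule:
  assumes "bimodule V S"
  shows "op_projection V (projection_onto V S)" "img V (projection_onto V S) = S"
proof -
  have "\<exists>!p. op_projection V p \<and> img V p = S"
    using bimodule_projection_exists[OF assms] op_projection_unique by blast
  from theI'[OF this] show "op_projection V (projection_onto V S)" "img V (projection_onto V S) = S"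
    unfolding projection_onto_def by auto
qed

lemma commutant_dagger: "v \<in> commutant V \<Longrightarrow> dagger v \<in> commutant V"
proof -
  assume v: "v \<in> commutant V"
  have "dagger v ** a = a ** dagger v" if "a \<in> alg V" for a
  proof -
    have "dagger a \<in> alg V" using that unfolding alg_def ops_def dagger_def by simp
    then have "v ** dagger a = dagger a ** v" using v by (simp add: commutant_def)
    then show ?thesis by (metis dagger_mult dagger_dagger)
  qed
  moreover have "dagger v \<in> ops V" using v by (auto simp: commutant_def ops_def dagger_def)
  ultimately show ?thesis by (simp add: commutant_def)
qed

lemma commutant_mult: "v \<in> commutant V \<Longrightarrow> w \<in> commutant V \<Longrightarrow> v ** w \<in> commutant V"
  by (simp add: commutant_def mult_in_ops) (metis matrix_mul_assoc)

lemma cscale_mult: "cscale c a ** b = cscale c (a ** b)" "a ** cscale c b = cscale c (a ** b)"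
  by (simp_all add: cscale_def matrix_matrix_mult_def vec_eq_iff sum_distrib_left mult_ac)

lemma cmat_add_rdistrib: "(a + b) ** c = a ** c + b ** c" for a :: "'n::finite cmat"
  by (simp add: matrix_matrix_mult_def vec_eq_iff algebra_simps sum.distrib)

lemma cmat_diff_ldistrib: "a ** (b - c) = a ** b - a ** c" for a :: "'n::finite cmat"
  by (simp add: matrix_matrix_mult_def vec_eq_iff algebra_simps sum_subtractf)

lemma cmat_diff_rdistrib: "(a - b) ** c = a ** c - b ** c" for a :: "'n::finite cmat"
  by (simp add: matrix_matrix_mult_def vec_eq_iff algebra_simps sum_subtractf)

lemma cmat_mult_zero: "0 ** a = 0" "a ** 0 = 0" for a :: "'n::finite cmat"
  by (simp_all add: matrix_matrix_mult_def vec_eq_iff)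

lemma csubspace_commutant: "csubspace (commutant V)"
proof -
  have "x + y \<in> commutant V" if "x \<in> commutant V" "y \<in> commutant V" for x y
    using that csubspace_ops[of V]
    unfolding commutant_def csubspace_def mem_Collect_eq matrix_add_ldistrib cmat_add_rdistrib
    by metis
  moreover have "cscale c x \<in> commutant V" if "x \<in> commutant V" for c x
    using that csubspace_ops[of V]
    unfolding commutant_def csubspace_def mem_Collect_eq cscale_mult by metis
  moreover have "0 \<in> commutant V"
    using csubspace_ops[of V] by (simp add: commutant_def csubspace_def cmat_mult_zero)
  ultimately show ?thesis unfolding csubspace_def by blast
qed

lemma bimodule_commutant: "bimodule V (commutant V)"
  unfolding bimodule_def using csubspace_commutant commutant_mult by (auto simp: commutant_def)

lemma img_compl_diagonal:
  "img V (compl V (diagonal V)) = {x \<in> ops V. \<forall>v \<in> commutant V. hs_inner v x = 0}"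
  unfolding diagonal_def img_compl[OF projection_onto_bimodule(1)[OF bimodule_commutant]]
    projection_onto_bimodule(2)[OF bimodule_commutant] ..


section \<open>Projections of projective subsets\<close>

text \<open>
  Testing the weighted inner product of \<open>V\<close> against a matrix unit recovers an entry up to the
  dimension of its block. Both sides of the adjointness identity below carry the same nonzero factor, so
  self-adjointness of a projective subset becomes self-adjointness of its projection as a matrix.
\<close>

lemma ip_unit_left:
  assumes "i \<in> idx V" "j \<in> idx V" "blk V i = blk V j"
  shows "ip V (axis i (axis j 1)) y = of_nat (block_dim V (blk V i)) * y $ i $ j"
proof -
  let ?e = "axis i (axis j 1) :: 'a cmat"
  have s: "summand V \<beta> ?e = (if \<beta> = blk V i then ?e else 0)" for \<beta>
    using assms by (auto simp: summand_def vec_eq_iff axis_axis_nth)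
  have h: "trace (dagger (summand V \<beta> ?e) ** summand V \<beta> y)
      = (if \<beta> = blk V i then y $ i $ j else 0)" for \<beta>
    using assms unfolding hs_inner_def[symmetric] s
    by (auto simp: hs_inner_unit_left summand_def) (simp add: hs_inner_sum)
  have "ip V ?e y = (\<Sum>\<beta>\<in>blk V ` idx V.
      if \<beta> = blk V i then of_nat (block_dim V (blk V i)) * y $ i $ j else 0)"
    unfolding ip_def h by (intro sum.cong) auto
  then show ?thesis using assms by simp
qed

lemma cnj_ip: "cnj (ip V x y) = ip V y x"
  by (simp add: ip_def hs_inner_def[symmetric] cnj_hs_inner)

lemma one_of_in_alg: "one_of V \<in> alg V"
  by (auto simp: alg_def ops_def one_of_def)

lemma projection_of_projective_subset:
  assumes "projective_subset V X"
  shows "projection_of V X \<in> alg V" "projection_of V X ** projection_of V X = projection_of V X"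
    "dagger (projection_of V X) = projection_of V X"
proof -
  let ?p = "projection_of V X"
  show p: "?p \<in> alg V"
    using assms one_of_in_alg by (auto simp: projective_subset_def clinear_map_def projection_of_def)
  have X: "X a = ?p ** a" if "a \<in> alg V" for a
  proof -
    have "X (one_of V ** a) = X (one_of V) ** a"
      using assms one_of_in_alg[of V] that by (simp add: projective_subset_def)
    moreover have "one_of V ** a = a" using that one_of_mult_ops by (auto simp: alg_def)
    ultimately show ?thesis by (simp add: projection_of_def)
  qed
  have "X (X (one_of V)) = X (one_of V)"
    using assms one_of_in_alg by (auto simp: projective_subset_def)
  then show "?p ** ?p = ?p"
    using X[OF p] by (simp add: projection_of_def)
  have "cnj (?p $ k $ i) = ?p $ i $ k" for i k
  proof (cases "i \<in> idx V \<and> k \<in> idx V \<and> blk V i = blk V k")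
    case False
    then have "?p $ k $ i = 0" "?p $ i $ k = 0" using p unfolding alg_def ops_def by (simp, metis)+
    then show ?thesis by simp
  next
    case True
    let ?a = "axis i (axis i 1) :: 'a cmat" and ?b = "axis k (axis i 1) :: 'a cmat"
    have ab: "?a \<in> alg V" "?b \<in> alg V" using True by (auto simp: alg_def ops_def axis_axis_nth)
    have col: "(?p ** axis l (axis i 1)) $ m $ i = ?p $ m $ l" for l m
    proof -
      have "?p $ m $ n * axis l (axis i 1) $ n $ i = (if n = l then ?p $ m $ l else 0)" for n
        by (simp add: axis_axis_nth)
      then show ?thesis by (simp add: matrix_matrix_mult_def)
    qed
    have "ip V (?p ** ?a) ?b = ip V ?a (?p ** ?b)"
      using assms ab X by (auto simp: projective_subset_def)
    then have "cnj (ip V ?b (?p ** ?a)) = ip V ?a (?p ** ?b)" by (simp add: cnj_ip)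
    then have "of_nat (block_dim V (blk V i)) * cnj (?p $ k $ i)
        = (of_nat (block_dim V (blk V i)) * ?p $ i $ k :: complex)"
      using True by (simp add: ip_unit_left col)
    moreover have "block_dim V (blk V i) \<noteq> 0" using True by (auto simp: block_dim_def card_eq_0_iff)
    ultimately show ?thesis by simp
  qed
  then show "dagger ?p = ?p" by (simp add: dagger_def vec_eq_iff)
qed


section \<open>Weak and Weaver independent sets\<close>

text \<open>
  The intersection of the two images is a bimodule because \<open>p\<close> commutes with the commutant, and
  because the commutant, being a star algebra, has a bimodule as orthogonal complement.
\<close>

lemma img_setdiff_diagonal:
  assumes "projective_subset V X"
  defines "p \<equiv> projection_of V X"
  shows "img V (setdiff V (cart_prod V X X) (diagonal V))
    = {x \<in> ops V. p ** x ** p = x \<and> (\<forall>v \<in> commutant V. hs_inner v x = 0)}" (is "_ = ?W")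
proof -
  note p = projection_of_projective_subset[OF assms(1), folded p_def]
  have pops: "p \<in> ops V" using p(1) by (simp add: alg_def)
  have pp: "p ** (p ** x) = p ** x" for x by (simp add: matrix_mul_assoc p(2))
  have "img V (cart_prod V X X) = {x \<in> ops V. p ** x ** p = x}"
  proof (intro set_eqI iffI)
    fix x assume "x \<in> img V (cart_prod V X X)"
    then show "x \<in> {x \<in> ops V. p ** x ** p = x}"
      using pops p(2) pp by (auto simp: img_def cart_prod_def act_kron mult_in_ops simp flip: p_def matrix_mul_assoc)
  next
    fix x assume "x \<in> {x \<in> ops V. p ** x ** p = x}"
    then show "x \<in> img V (cart_prod V X X)"
      by (force simp: img_def cart_prod_def act_kron simp flip: p_def)
  qed
  then have W: "img V (cart_prod V X X) \<inter> img V (compl V (diagonal V)) = ?W"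
    by (auto simp: img_compl_diagonal)
  have comm: "p ** v = v ** p" if "v \<in> commutant V" for v
    using that p(1) by (simp add: commutant_def)
  have "bimodule V ?W"
    unfolding bimodule_def
  proof (intro conjI ballI)
    show "?W \<subseteq> ops V" by auto
    show "csubspace ?W"
      using csubspace_ops[of V]
      by (simp add: csubspace_def cscale_mult matrix_add_ldistrib cmat_add_rdistrib cmat_mult_zero
          hs_inner_add_right hs_inner_cscale_right hs_inner_zero_right)
    fix v s assume v: "v \<in> commutant V" and s: "s \<in> ?W"
    have vo: "v \<in> ops V" using v by (simp add: commutant_def)
    have s': "s \<in> ops V" "p ** s ** p = s" using s by auto
    have so: "hs_inner (dagger v ** w) s = 0" "hs_inner (w ** dagger v) s = 0" if "w \<in> commutant V" for w
      using s that v by (auto intro: commutant_mult commutant_dagger)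
    have "p ** (v ** s) ** p = v ** (p ** s ** p)" "p ** (s ** v) ** p = (p ** s ** p) ** v"
      using comm[OF v] by (metis matrix_mul_assoc)+
    then show "v ** s \<in> ?W" "s ** v \<in> ?W"
      using s' so vo by (auto simp: mult_in_ops hs_inner_mult_left[of _ v] hs_inner_mult_right[of _ _ v])
  qed
  from projection_onto_bimodule(2)[OF this] show ?thesis
    unfolding setdiff_def inter_def W .
qed

theorem proposition4p37:
  fixes V :: "('n::finite, 'b) qset"
    and A :: "'n cmat \<Rightarrow> 'n cmat"
    and X :: "'n cmat \<Rightarrow> 'n cmat"
  assumes "quantum_graph V A"
    and "undirected V A"
    and "projective_subset V X"
  shows "weak_independent_set V A X \<longleftrightarrow>
         weaver_independent_set V (operator_space V A) (projection_of V X)"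
proof -
  define p where "p = projection_of V X"
  define S where "S = operator_space V A"
  define W where "W = {x \<in> ops V. p ** x ** p = x \<and> (\<forall>v \<in> commutant V. hs_inner v x = 0)}"
  note p = projection_of_projective_subset[OF assms(3), folded p_def]
  have pops: "p \<in> ops V" using p(1) by (simp add: alg_def)
  have weak: "weak_independent_set V A X \<longleftrightarrow> (\<forall>x\<in>W. \<forall>s\<in>S. hs_inner x s = 0)"
    unfolding weak_independent_set_def disjoint_proj_def img_setdiff_diagonal[OF assms(3)]
      W_def p_def S_def operator_space_def ..
  have corner: "hs_inner x (p ** y ** p) = hs_inner (p ** x ** p) y" for x y
    by (simp add: hs_inner_compress p(3))
  define C where "C = (\<lambda>v. p ** v ** p) ` commutant V"
  have C: "csubspace C"
    unfolding C_def using csubspace_commutant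
    by (rule csubspace_image) (simp_all add: cscale_mult matrix_add_ldistrib cmat_add_rdistrib)
  show ?thesis unfolding weak weaver_independent_set_def S_def[symmetric] p_def[symmetric] C_def[symmetric]
  proof
    assume W: "\<forall>x\<in>W. \<forall>s\<in>S. hs_inner x s = 0"
    show "(\<lambda>s. p ** s ** p) ` S \<subseteq> C"
    proof clarify
      fix s assume s: "s \<in> S"
      (* Split the compression of s into its part y in C and a remainder; the remainder lies in W,
         hence is orthogonal to s, and therefore to itself. *)
      obtain y where y: "y \<in> C" "\<forall>c\<in>C. hs_inner c (p ** s ** p - y) = 0"
        using orthogonal_decomposition[OF C] by blast
      let ?z = "p ** s ** p - y"
      obtain v where v: "v \<in> commutant V" "y = p ** v ** p" using y(1) by (auto simp: C_def)
      have z: "?z = p ** (s - v) ** p" unfolding v(2)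
        by (simp add: cmat_diff_ldistrib cmat_diff_rdistrib)
      have zp: "p ** ?z ** p = ?z" unfolding z using p(2) by (metis matrix_mul_assoc)
      have "hs_inner w ?z = 0" if "w \<in> commutant V" for w
      proof -
        have "hs_inner w ?z = hs_inner (p ** w ** p) ?z" using corner[of w ?z] zp by simp
        also have "\<dots> = 0" using y(2) that by (simp add: C_def)
        finally show ?thesis .
      qed
      then have "?z \<in> W" unfolding W_def using zp corner_in_ops[OF pops pops] z by auto
      then have "hs_inner ?z s = 0" using W s by blast
      then have "hs_inner ?z (p ** s ** p) = 0" using corner[of ?z s] zp by simp
      moreover have "hs_inner ?z y = 0"
        using y(2)[rule_format, OF y(1)] cnj_hs_inner[of y ?z] by simp
      ultimately have "hs_inner ?z ?z = 0" by (simp add: hs_inner_diff_right[of ?z])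
      then have "?z = 0" by (rule hs_inner_self_eq_0)
      then show "p ** s ** p \<in> C" using y by simp
    qed
  next
    assume WI: "(\<lambda>s. p ** s ** p) ` S \<subseteq> C"
    show "\<forall>x\<in>W. \<forall>s\<in>S. hs_inner x s = 0"
    proof (intro ballI)
      fix x s assume x: "x \<in> W" and s: "s \<in> S"
      obtain v where v: "v \<in> commutant V" "p ** s ** p = p ** v ** p" using WI s unfolding C_def by blast
      have "p ** x ** p = x" and vx: "hs_inner v x = 0" using x v by (auto simp: W_def)
      then have "hs_inner x s = hs_inner x v" by (metis corner v(2))
      then show "hs_inner x s = 0" using vx cnj_hs_inner[of v x] by simp
    qed
  qed
qed

end
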